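(* Let $r\geq 3$ be an integer, let $n\ge 2$ be an integer, and let $\alpha$ be a real number with $(\ln n)^{-1/(r-1)}\leq\alpha\leq r^{-3}$. Let $U_{1},\ldots,U_{r}$ be sets of size $n$ and let $M\subset U_{1}\times\cdots\times U_{r}$ satisfy $|M|\geq\alpha n^{r}$. If the positive integers $s_{1},\ldots,s_{r-1}$ satisfy $1\leq s_{1}s_2\cdots s_{r-1}\leq\alpha^{r-1}\ln n$, then there exist sets $V_{i}\subset U_{i}$ $(1\le i\le r)$ such that $V_{1}\times\cdots\times V_{r}\subset M$, $|V_{i}|=s_{i}$ for $1\leq i<r$, and $|V_{r}|>n^{1-\alpha^{r-2}}$.
   Context: $\ln$ is the natural logarithm. The sets $U_1,\dots,U_r$ are not assumed to be disjoint or distinct. The symbol $\subset$ allows equality. *)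

theory Defs
  imports Complex_Main "HOL-Library.FuncSet"
begin

end

theory Submission imports Defs
begin

text \<open>
  Double counting in the spirit of Erdos. Replace the coordinates of \<open>M\<close> one after the other by
  sets of the prescribed size: passing from single points of \<open>U\<^sub>j\<close> to \<open>s\<^sub>j\<close>-element subsets turns a
  density \<open>\<delta>\<close> of complete boxes into a density of at least \<open>(\<delta>/2)\<^sup>s\<close> with \<open>s = s\<^sub>j\<close>, by convexity.
  After \<open>r - 1\<close> steps the density is at least \<open>\<beta> = (\<alpha>/2\<^bsup>r-1\<^esup>)\<^bsup>P\<^esup>\<close> with \<open>P = s\<^sub>1\<cdots>s\<^bsub>r-1\<^esub>\<close>, so
  some choice of \<open>V\<^sub>1, \<dots>, V\<^bsub>r-1\<^esub>\<close> extends by at least \<open>\<beta> n\<close> points of \<open>U\<^sub>r\<close>.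
  Since \<open>\<alpha> (ln (1/\<alpha>) + (r-1) ln 2) \<le> 1/2\<close>, this exceeds the required bound.
\<close>

section \<open>Boxes contained in \<open>M\<close> and their extensions by one coordinate\<close>

text \<open>The size profile \<open>t\<close> is a parameter so that one notion covers every stage:
  for \<open>M\<close> inside the product, the constant profile 1 gives the points of
  \<open>M\<close>, written as families of singletons, and raising its entries one by one leads to
  the boxes sought.\<close>

definition complete_boxes ::
  "'i set \<Rightarrow> ('i \<Rightarrow> 'a set) \<Rightarrow> ('i \<Rightarrow> 'a) set \<Rightarrow> ('i \<Rightarrow> nat) \<Rightarrow> ('i \<Rightarrow> 'a set) set"
  where "complete_boxes I U M t =
    {V \<in> (\<Pi>\<^sub>E i\<in>I. {S. S \<subseteq> U i \<and> card S = t i}). Pi\<^sub>E I V \<subseteq> M}"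

text \<open>The common neighbourhood in \<open>U j\<close> of the box \<open>V\<close>, when
  \<open>M\<close> is read as a multipartite hypergraph.\<close>

definition box_extensions ::
  "'i set \<Rightarrow> ('i \<Rightarrow> 'a set) \<Rightarrow> ('i \<Rightarrow> 'a) set \<Rightarrow> 'i \<Rightarrow> ('i \<Rightarrow> 'a set) \<Rightarrow> 'a set"
  where "box_extensions I U M j V = {x \<in> U j. Pi\<^sub>E (insert j I) (V(j := {x})) \<subseteq> M}"

text \<open>A box is the union of its slices at coordinate \<open>j\<close>. Hence the sets
  admissible there are the subsets of a single set, the extension set, and a binomial coefficient
  counts them.\<close>

lemma PiE_insert_subset_iff:
  "Pi\<^sub>E (insert j I) (V(j := S)) \<subseteq> M \<longleftrightarrow>
     (\<forall>x\<in>S. Pi\<^sub>E (insert j I) (V(j := {x})) \<subseteq> M)"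
proof -
  have "Pi\<^sub>E (insert j I) (V(j := S)) = (\<Union>x\<in>S. Pi\<^sub>E (insert j I) (V(j := {x})))"
    by (fastforce simp: PiE_iff)
  then show ?thesis
    by auto
qed

lemma finite_subsets_of_card: "finite A \<Longrightarrow> finite {S. S \<subseteq> A \<and> card S = k}"
  by (rule finite_subset[of _ "Pow A"]) auto

text \<open>Each box is split into its restriction to \<open>I\<close> and its \<open>j\<close>-th
  side. As \<open>j\<close> lies outside \<open>I\<close>, neither the range of the sum nor the
  extension sets depend on \<open>t j\<close>: changing \<open>t j\<close> changes only the lower
  index of the binomials.\<close>

lemma card_complete_boxes_insert:
  fixes t :: "'i \<Rightarrow> nat"
  assumes "finite I" "j \<notin> I" "\<And>i. i \<in> insert j I \<Longrightarrow> finite (U i)"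
  shows "card (complete_boxes (insert j I) U M t) =
    (\<Sum>V\<in>(\<Pi>\<^sub>E i\<in>I. {S. S \<subseteq> U i \<and> card S = t i}). card (box_extensions I U M j V) choose t j)"
proof -
  let ?X = "\<Pi>\<^sub>E i\<in>I. {S. S \<subseteq> U i \<and> card S = t i}"
  let ?E = "\<lambda>V. {S. S \<subseteq> box_extensions I U M j V \<and> card S = t j}"
  let ?g = "\<lambda>(V, S). V(j := S)"
  have fin: "finite (box_extensions I U M j V)" for V
    using assms(3)[of j] by (auto simp: box_extensions_def)
  have finX: "finite ?X"
    using assms by (intro finite_PiE finite_subsets_of_card) auto
  have img: "complete_boxes (insert j I) U M t = ?g ` (SIGMA V:?X. ?E V)"
  proof (intro equalityI subsetI)
    fix W assume W: "W \<in> complete_boxes (insert j I) U M t"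
    \<comment> \<open>Resetting the value at \<open>j\<close> to \<open>undefined\<close> makes the
      restriction extensional on \<open>I\<close>.\<close>
    define V where "V = W(j := undefined)"
    have WV: "W = V(j := W j)"
      by (simp add: V_def)
    have "V \<in> ?X"
      using W assms(2) by (auto simp: complete_boxes_def V_def PiE_iff extensional_def)
    moreover have "Pi\<^sub>E (insert j I) (V(j := W j)) \<subseteq> M"
      using W WV by (simp add: complete_boxes_def)
    then have "W j \<in> ?E V"
      using W unfolding PiE_insert_subset_iff[of j I V "W j" M]
      by (auto simp: complete_boxes_def box_extensions_def)
    ultimately show "W \<in> ?g ` (SIGMA V:?X. ?E V)"
      using WV by (intro image_eqI[of _ _ "(V, W j)"]) auto
  next
    fix W assume "W \<in> ?g ` (SIGMA V:?X. ?E V)"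
    then obtain V S where VS: "V \<in> ?X" "S \<in> ?E V" "W = V(j := S)"
      by auto
    have "Pi\<^sub>E (insert j I) (V(j := S)) \<subseteq> M"
      using VS(2) unfolding PiE_insert_subset_iff[of j I V S M] by (auto simp: box_extensions_def)
    moreover have "S \<subseteq> U j" "card S = t j"
      using VS(2) by (auto simp: box_extensions_def)
    ultimately show "W \<in> complete_boxes (insert j I) U M t"
      using VS(1,3) by (auto simp: complete_boxes_def PiE_iff extensional_def)
  qed
  have "inj_on ?g (SIGMA V:?X. ?E V)"
  proof (rule inj_onI, clarsimp)
    fix V S V' S'
    assume V: "V \<in> ?X" "V' \<in> ?X" and eq: "V(j := S) = V'(j := S')"
    \<comment> \<open>Both values are \<open>undefined\<close>, so nothing about \<open>V\<close> is
      lost when the entry at \<open>j\<close> is overwritten.\<close>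
    have "V j = V' j"
      using V assms(2) by (auto simp: PiE_iff extensional_def)
    then have "V = V'"
      using eq by (metis fun_upd_triv fun_upd_upd)
    moreover have "S = S'"
      using eq by (metis fun_upd_same)
    ultimately show "V = V' \<and> S = S'" ..
  qed
  then have "card (complete_boxes (insert j I) U M t) = card (SIGMA V:?X. ?E V)"
    unfolding img by (rule card_image)
  also have "\<dots> = (\<Sum>V\<in>?X. card (?E V))"
    using finX fin by (intro card_SigmaI) (auto intro: finite_subsets_of_card)
  also have "\<dots> = (\<Sum>V\<in>?X. card (box_extensions I U M j V) choose t j)"
    by (intro sum.cong refl n_subsets fin)
  finally show ?thesis .
qed

section \<open>Convexity estimates for binomial coefficients\<close>

text \<open>Compare the product formulas factor by factor: \<open>n - i\<close> is at most
  \<open>n\<close>, and \<open>d - s\<close> is at most \<open>d - i\<close>. Using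
  \<open>d - s\<close> in every factor leaves a pure power of a linear function of
  \<open>d\<close>.\<close>

lemma binomial_ratio_ge:
  assumes "s \<le> d" "d \<le> n" "n > 0"
  shows "real (n choose s) * ((real d - real s) / real n) ^ s \<le> real (d choose s)"
proof -
  have "real (n choose s) * ((real d - real s) / real n) ^ s =
      (\<Prod>i = 0..<s. real (n - i) / real (s - i)) * (\<Prod>i = 0..<s. (real d - real s) / real n)"
    using assms by (simp add: binomial_altdef_of_nat)
  also have "\<dots> = (\<Prod>i = 0..<s. real (n - i) / real (s - i) * ((real d - real s) / real n))"
    by (rule prod.distrib[symmetric])
  also have "\<dots> \<le> (\<Prod>i = 0..<s. real (d - i) / real (s - i))"
  proof (intro prod_mono conjI)
    fix i assume i: "i \<in> {0..<s}"
    show "0 \<le> real (n - i) / real (s - i) * ((real d - real s) / real n)"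
      using assms by auto
    have "real (n - i) * ((real d - real s) / real n) \<le> real n * ((real d - real s) / real n)"
      using assms by (intro mult_right_mono) auto
    also have "\<dots> \<le> real (d - i)"
      using assms i by (simp add: of_nat_diff)
    finally have "real (n - i) * ((real d - real s) / real n) / real (s - i)
        \<le> real (d - i) / real (s - i)"
      by (intro divide_right_mono) auto
    then show "real (n - i) / real (s - i) * ((real d - real s) / real n)
        \<le> real (d - i) / real (s - i)"
      by (simp add: mult.commute)
  qed
  also have "\<dots> = real (d choose s)"
    using assms by (simp add: binomial_altdef_of_nat)
  finally show ?thesis .
qed

text \<open>
  A tangent line at \<open>d = a n + s\<close> in place of the convexity of \<open>d choose s\<close>, so that the
  bound can be summed; for \<open>d < s\<close> the right-hand side is not positive.
\<close>
lemma binomial_tangent_le: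
  fixes a :: real
  assumes "d \<le> n" "n > 0" "s > 0" "a > 0"
  shows "real (n choose s) * a ^ s * (1 + real s * ((real d - real s) / (real n * a) - 1))
    \<le> real (d choose s)"
proof (cases "s \<le> d")
  case True
  define x where "x = (real d - real s) / real n"
  have x: "x \<ge> 0"
    using True by (simp add: x_def)
  \<comment> \<open>Bernoulli's inequality is the tangent bound for the \<open>s\<close>-th power at
    \<open>x = a\<close>; its side condition holds because \<open>x\<close> is nonnegative.\<close>
  have "1 + real s * (x / a - 1) \<le> (1 + (x / a - 1)) ^ s"
    using x assms by (intro Bernoulli_inequality) simp
  then have "a ^ s * (1 + real s * (x / a - 1)) \<le> a ^ s * (x / a) ^ s"
    using assms by (intro mult_left_mono) auto
  also have "\<dots> = x ^ s"
    using assms by (simp add: power_divide)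
  finally have "real (n choose s) * (a ^ s * (1 + real s * (x / a - 1)))
      \<le> real (n choose s) * x ^ s"
    by (intro mult_left_mono) auto
  also have "\<dots> \<le> real (d choose s)"
    unfolding x_def using True assms by (intro binomial_ratio_ge) auto
  finally show ?thesis
    by (simp add: x_def mult.assoc)
next
  case False
  have "(real d - real s) / (real n * a) \<le> 0"
    using False assms by (intro divide_nonpos_pos) auto
  then have "real s * ((real d - real s) / (real n * a) - 1) \<le> real s * (- 1)"
    by (intro mult_left_mono) auto
  then have "1 + real s * ((real d - real s) / (real n * a) - 1) \<le> 0"
    using assms by linarith
  then have "real (n choose s) * a ^ s * (1 + real s * ((real d - real s) / (real n * a) - 1)) \<le> 0"
    using assms by (intro mult_nonneg_nonpos) auto
  then show ?thesis
    by linarith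
qed

text \<open>A form of Jensen's inequality, with the tangent taken at
  \<open>a = \<delta> / 2\<close>. One half of the density pays for the shift by \<open>s\<close>,
  as \<open>s\<close> is at most \<open>\<delta> * n / 2\<close>. The average of
  \<open>d x - s\<close> is then at least \<open>a * n\<close>, so the linear corrections have a
  nonnegative sum and the constant terms remain.\<close>

lemma sum_binomial_ge:
  fixes \<delta> :: real
  assumes "finite X" "n > 0" "s > 0" "\<delta> > 0" "2 * real s \<le> \<delta> * real n"
    and d: "\<And>x. x \<in> X \<Longrightarrow> d x \<le> n"
    and avg: "(\<Sum>x\<in>X. real (d x)) \<ge> \<delta> * real n * real (card X)"
  shows "(\<Sum>x\<in>X. real (d x choose s)) \<ge> (\<delta> / 2) ^ s * real (n choose s) * real (card X)"
proof -
  define a where "a = \<delta> / 2"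
  have a: "a > 0"
    using assms by (simp add: a_def)
  have "real n * a * real (card X) \<le> (\<Sum>x\<in>X. real (d x) - real s)"
  proof -
    have "real s * real (card X) \<le> a * real n * real (card X)"
      using assms by (intro mult_right_mono) (auto simp: a_def)
    then show ?thesis
      using avg by (simp add: sum_subtractf a_def algebra_simps)
  qed
  then have "real (card X) \<le> (\<Sum>x\<in>X. real (d x) - real s) / (real n * a)"
    using a assms by (simp add: field_simps)
  then have "real s * real (card X) \<le> real s * ((\<Sum>x\<in>X. real (d x) - real s) / (real n * a))"
    by (intro mult_left_mono) auto
  then have 1: "real (card X) \<le>
      (\<Sum>x\<in>X. 1 + real s * ((real (d x) - real s) / (real n * a) - 1))"
    by (simp add: sum.distrib sum_subtractf right_diff_distrib mult_ac
        flip: sum_distrib_left sum_divide_distrib)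
  have "real (n choose s) * a ^ s * real (card X) \<le>
      real (n choose s) * a ^ s * (\<Sum>x\<in>X. 1 + real s * ((real (d x) - real s) / (real n * a) - 1))"
    using 1 a by (intro mult_left_mono) auto
  also have "\<dots> \<le> (\<Sum>x\<in>X. real (d x choose s))"
    unfolding sum_distrib_left using assms a by (intro sum_mono binomial_tangent_le) auto
  finally show ?thesis
    by (simp add: a_def mult_ac)
qed

section \<open>Propagating the density of complete boxes coordinate by coordinate\<close>

lemma card_PiE_subsets:
  assumes "finite I" "\<And>i. i \<in> I \<Longrightarrow> finite (U i)"
  shows "card (\<Pi>\<^sub>E i\<in>I. {S. S \<subseteq> U i \<and> card S = t i}) = (\<Prod>i\<in>I. card (U i) choose t i)"
  using assms by (simp add: card_PiE n_subsets)

text \<open>Both counts are sums over the same families on \<open>I\<close>: of the extension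
  numbers when the entry at \<open>j\<close> is 1, and of their binomials when it is
  \<open>s\<close>. The assumed density says that the extension numbers average at least
  \<open>\<delta> * n\<close>, which is what \<open>sum_binomial_ge\<close> asks for.\<close>

lemma card_complete_boxes_step:
  fixes \<delta> :: real
  assumes I: "finite I" "j \<notin> I" and fin: "\<And>i. i \<in> insert j I \<Longrightarrow> finite (U i)"
    and n: "card (U j) = n" "n > 0" and s: "s > 0" "2 * real s \<le> \<delta> * real n" and \<delta>: "\<delta> > 0"
    and t: "t j = 1"
    and dens: "real (card (complete_boxes (insert j I) U M t)) \<ge>
      \<delta> * real (\<Prod>i\<in>insert j I. card (U i) choose t i)"
  shows "real (card (complete_boxes (insert j I) U M (t(j := s)))) \<ge>
      (\<delta> / 2) ^ s * real (\<Prod>i\<in>insert j I. card (U i) choose (t(j := s)) i)"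
proof -
  let ?X = "\<Pi>\<^sub>E i\<in>I. {S. S \<subseteq> U i \<and> card S = t i}"
  let ?d = "\<lambda>V. card (box_extensions I U M j V)"
  have X: "card ?X = (\<Prod>i\<in>I. card (U i) choose t i)"
    using I fin by (intro card_PiE_subsets) auto
  have finX: "finite ?X"
    using I fin by (intro finite_PiE finite_subsets_of_card) auto
  have d: "?d V \<le> n" for V
    unfolding n(1)[symmetric] using fin by (intro card_mono) (auto simp: box_extensions_def)
  have "(\<Sum>V\<in>?X. real (?d V)) \<ge> \<delta> * real n * real (card ?X)"
    using dens card_complete_boxes_insert[OF I, of U M t, OF fin] I n t by (simp add: X)
  then have "(\<Sum>V\<in>?X. real (?d V choose s)) \<ge> (\<delta> / 2) ^ s * real (n choose s) * real (card ?X)"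
    using finX n s \<delta> d by (intro sum_binomial_ge) auto
  moreover have "(\<Pi>\<^sub>E i\<in>I. {S. S \<subseteq> U i \<and> card S = (t(j := s)) i}) = ?X"
    using I by (intro PiE_cong) auto
  moreover have "(\<Prod>i\<in>I. card (U i) choose (t(j := s)) i) = card ?X"
    unfolding X using I by (intro prod.cong) auto
  ultimately show ?thesis
    using card_complete_boxes_insert[OF I, of U M "t(j := s)", OF fin] I n by (simp add: mult.assoc)
qed

lemma card_le_card_singleton_boxes:
  assumes "finite I" "\<And>i. i \<in> I \<Longrightarrow> finite (U i)" "M \<subseteq> Pi\<^sub>E I U"
  shows "card M \<le> card (complete_boxes I U M (\<lambda>_. 1))"
proof (rule card_inj_on_le)
  let ?g = "\<lambda>f. \<lambda>i\<in>I. {f i}"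
  show "inj_on ?g M"
  proof (rule inj_onI)
    fix f g assume fg: "f \<in> M" "g \<in> M" "?g f = ?g g"
    show "f = g"
    proof (rule PiE_ext)
      show "f \<in> Pi\<^sub>E I U" "g \<in> Pi\<^sub>E I U"
        using fg assms by auto
      show "f i = g i" if "i \<in> I" for i
        using fun_cong[OF fg(3), of i] that by simp
    qed
  qed
  show "?g ` M \<subseteq> complete_boxes I U M (\<lambda>_. 1)"
  proof (rule image_subsetI)
    fix f assume f: "f \<in> M"
    then have fU: "f \<in> Pi\<^sub>E I U"
      using assms by auto
    then have "Pi\<^sub>E I (?g f) = {f}"
      using PiE_singleton[of f I] by (simp add: PiE_iff cong: PiE_cong)
    then show "?g f \<in> complete_boxes I U M (\<lambda>_. 1)"
      using f fU by (auto simp: complete_boxes_def)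
  qed
  show "finite (complete_boxes I U M (\<lambda>_. 1))"
    unfolding complete_boxes_def
    using assms by (intro finite_Collect_conjI disjI1)
      (auto simp only: Collect_mem_eq intro!: finite_PiE finite_subsets_of_card)
qed

text \<open>Induction on the set \<open>J\<close> of coordinates already enlarged. The size
  condition is stated only for the final density, since every intermediate density is at least as
  large.\<close>

lemma card_complete_boxes_ge:
  fixes \<alpha> :: real
  assumes I: "finite I" "J0 \<subseteq> I" and fin: "\<And>i. i \<in> I \<Longrightarrow> finite (U i)"
    and n: "\<And>i. i \<in> I \<Longrightarrow> card (U i) = n" "n > 0"
    and M: "M \<subseteq> Pi\<^sub>E I U" "real (card M) \<ge> \<alpha> * real n ^ card I"
    and \<alpha>: "0 < \<alpha>" "\<alpha> \<le> 1"
    and s: "\<And>i. i \<in> J0 \<Longrightarrow> s i > 0"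
      "\<And>i. i \<in> J0 \<Longrightarrow> 2 * real (s i) \<le> (\<alpha> / 2 ^ card J0) ^ (\<Prod>i\<in>J0. s i) * real n"
  shows "real (card (complete_boxes I U M (\<lambda>i. if i \<in> J0 then s i else 1))) \<ge>
    (\<alpha> / 2 ^ card J0) ^ (\<Prod>i\<in>J0. s i) * real (\<Prod>i\<in>I. card (U i) choose (if i \<in> J0 then s i else 1))"
proof -
  have "finite J0"
    using I finite_subset by auto
  moreover have "real (card (complete_boxes I U M (\<lambda>i. if i \<in> J then s i else 1))) \<ge>
    (\<alpha> / 2 ^ card J) ^ (\<Prod>i\<in>J. s i) * real (\<Prod>i\<in>I. card (U i) choose (if i \<in> J then s i else 1))"
    if "finite J" "J \<subseteq> J0" for J
    using that
  proof (induction J rule: finite_induct)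
    case empty
    then show ?case
      using card_le_card_singleton_boxes[OF I(1) fin M(1)] M(2) n by simp
  next
    case (insert j J)
    define t where "t = (\<lambda>i. if i \<in> J then s i else 1)"
    define P where "P = (\<Prod>i\<in>J. s i)"
    define \<delta> where "\<delta> = (\<alpha> / 2 ^ card J) ^ P"
    have j: "j \<in> J0" "j \<in> I" and sj: "s j > 0"
      using insert I s by auto
    have P: "P > 0"
      unfolding P_def using insert s by (intro prod_pos) auto
    have \<delta>: "\<delta> > 0"
      using \<alpha> by (simp add: \<delta>_def)
    have tt: "(\<lambda>i. if i \<in> insert j J then s i else 1) = t(j := s j)"
      by (auto simp: t_def)
    have I': "insert j (I - {j}) = I"
      using j by auto
    \<comment> \<open>Passing from \<open>J\<close> to \<open>J0\<close> first shrinks the base and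
      then, the base being at most 1, raises the exponent; both lower the density.\<close>
    have "(\<alpha> / 2 ^ card J0) ^ (\<Prod>i\<in>J0. s i) \<le> (\<alpha> / 2 ^ card J) ^ (\<Prod>i\<in>J0. s i)"
      using \<alpha> insert \<open>finite J0\<close>
      by (intro power_mono divide_left_mono power_increasing card_mono) auto
    also have "\<dots> \<le> \<delta>"
      unfolding \<delta>_def
    proof (rule power_decreasing)
      show "P \<le> (\<Prod>i\<in>J0. s i)"
        unfolding P_def using insert.prems \<open>finite J0\<close> s
        by (intro dvd_imp_le prod_dvd_prod_subset prod_pos) auto
      have "\<alpha> / 2 ^ card J \<le> \<alpha> / 1"
        using \<alpha> by (intro divide_left_mono) auto
      then show "\<alpha> / 2 ^ card J \<le> 1"
        using \<alpha> by linarith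
    qed (use \<alpha> in auto)
    finally have "(\<alpha> / 2 ^ card J0) ^ (\<Prod>i\<in>J0. s i) * real n \<le> \<delta> * real n"
      by (intro mult_right_mono) auto
    then have 2: "2 * real (s j) \<le> \<delta> * real n"
      using s(2)[OF j(1)] by linarith
    have IH: "real (card (complete_boxes I U M t)) \<ge> \<delta> * real (\<Prod>i\<in>I. card (U i) choose t i)"
      using insert by (simp add: t_def \<delta>_def P_def)
    have step: "real (card (complete_boxes I U M (t(j := s j)))) \<ge>
      (\<delta> / 2) ^ s j * real (\<Prod>i\<in>I. card (U i) choose (t(j := s j)) i)"
      using card_complete_boxes_step[where I = "I - {j}" and j = j and U = U and n = n and s = "s j"
          and \<delta> = \<delta> and t = t and M = M, unfolded I']
        I fin n j sj 2 \<delta> IH insert by (simp add: t_def)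
    \<comment> \<open>The step really costs one factor 2 inside the power \<open>s j\<close>. The
      closed form charges \<open>2 ^ P\<close> instead, which is at least 2 because \<open>P\<close>
      is positive.\<close>
    have "(\<alpha> / 2 ^ card (insert j J)) ^ P = \<delta> / 2 ^ P"
      using insert by (simp add: \<delta>_def power_divide power_mult_distrib)
    also have "\<dots> \<le> \<delta> / 2"
      using \<delta> P self_le_power[of "2::real" P] by (intro divide_left_mono) auto
    finally have "((\<alpha> / 2 ^ card (insert j J)) ^ P) ^ s j \<le> (\<delta> / 2) ^ s j"
      using \<alpha> by (intro power_mono) auto
    moreover have "(\<Prod>i\<in>insert j J. s i) = P * s j"
      using insert by (simp add: P_def)
    ultimately have "(\<alpha> / 2 ^ card (insert j J)) ^ (\<Prod>i\<in>insert j J. s i) \<le> (\<delta> / 2) ^ s j"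
      by (simp add: power_mult)
    then have "(\<alpha> / 2 ^ card (insert j J)) ^ (\<Prod>i\<in>insert j J. s i) *
        real (\<Prod>i\<in>I. card (U i) choose (t(j := s j)) i)
      \<le> (\<delta> / 2) ^ s j * real (\<Prod>i\<in>I. card (U i) choose (t(j := s j)) i)"
      by (rule mult_right_mono) (rule of_nat_0_le_iff)
    then have "(\<alpha> / 2 ^ card (insert j J)) ^ (\<Prod>i\<in>insert j J. s i) *
        real (\<Prod>i\<in>I. card (U i) choose (t(j := s j)) i)
      \<le> real (card (complete_boxes I U M (t(j := s j))))"
      using step by linarith
    then show ?case
      unfolding tt[symmetric] .
  qed
  ultimately show ?thesis
    by blast
qed

text \<open>Averaging: coordinate \<open>j\<close> keeps size 1, so the box count is the total
  number of extensions of families on \<open>I\<close>, and some family has at least the average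
  number. Its whole extension set becomes the last side.\<close>

lemma exists_large_box:
  fixes \<alpha> :: real
  assumes I: "finite I" "j \<notin> I" and n: "\<And>i. i \<in> insert j I \<Longrightarrow> card (U i) = n" "n > 0"
    and M: "M \<subseteq> Pi\<^sub>E (insert j I) U" "real (card M) \<ge> \<alpha> * real n ^ card (insert j I)"
    and \<alpha>: "0 < \<alpha>" "\<alpha> \<le> 1"
    and s: "\<And>i. i \<in> I \<Longrightarrow> s i > 0"
      "\<And>i. i \<in> I \<Longrightarrow> 2 * real (s i) \<le> (\<alpha> / 2 ^ card I) ^ (\<Prod>i\<in>I. s i) * real n"
  shows "\<exists>V. (\<forall>i\<in>insert j I. V i \<subseteq> U i) \<and> Pi\<^sub>E (insert j I) V \<subseteq> M \<and> (\<forall>i\<in>I. card (V i) = s i) \<and>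
    real (card (V j)) \<ge> (\<alpha> / 2 ^ card I) ^ (\<Prod>i\<in>I. s i) * real n"
proof -
  define \<beta> where "\<beta> = (\<alpha> / 2 ^ card I) ^ (\<Prod>i\<in>I. s i)"
  let ?t = "\<lambda>i. if i \<in> I then s i else 1"
  let ?X = "\<Pi>\<^sub>E i\<in>I. {S. S \<subseteq> U i \<and> card S = ?t i}"
  have fin: "finite (U i)" if "i \<in> insert j I" for i
    using n(1)[OF that] n(2) by (metis card.infinite less_irrefl)
  have \<beta>: "\<beta> > 0" "\<beta> \<le> 1"
  proof -
    show "\<beta> > 0"
      using \<alpha> by (simp add: \<beta>_def)
    have "\<alpha> / 2 ^ card I \<le> \<alpha> / 1"
      using \<alpha> by (intro divide_left_mono) auto
    then have "\<alpha> / 2 ^ card I \<le> 1"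
      using \<alpha> by linarith
    then show "\<beta> \<le> 1"
      unfolding \<beta>_def using \<alpha> by (intro power_le_one) auto
  qed
  \<comment> \<open>This makes the candidate families a nonempty set, so that an average over them
    exists.\<close>
  have sn: "s i \<le> n" if "i \<in> I" for i
  proof -
    have "\<beta> * real n \<le> 1 * real n"
      using \<beta> by (intro mult_right_mono) auto
    then show ?thesis
      using s(2)[OF that] by (simp flip: \<beta>_def)
  qed
  have X: "card ?X = (\<Prod>i\<in>I. card (U i) choose ?t i)"
    using I fin by (intro card_PiE_subsets) auto
  have "card ?X > 0"
    unfolding X using sn n I by (intro prod_pos) auto
  then have Xne: "finite ?X" "?X \<noteq> {}"
    using card_gt_0_iff by blast+
  have "\<beta> * real (\<Prod>i\<in>insert j I. card (U i) choose ?t i)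
      \<le> real (card (complete_boxes (insert j I) U M ?t))"
    unfolding \<beta>_def using I fin n M \<alpha> s by (intro card_complete_boxes_ge[of _ _ _ n]) auto
  also have "\<dots> = (\<Sum>V\<in>?X. real (card (box_extensions I U M j V)))"
    using card_complete_boxes_insert[OF I, of U M ?t, OF fin] I by simp
  finally have ge: "(\<Sum>V\<in>?X. \<beta> * real n) \<le> (\<Sum>V\<in>?X. real (card (box_extensions I U M j V)))"
    using I n X by (simp add: mult_ac)
  have "\<exists>V\<in>?X. \<beta> * real n \<le> real (card (box_extensions I U M j V))"
  proof (rule ccontr)
    assume "\<not> ?thesis"
    then have "(\<Sum>V\<in>?X. real (card (box_extensions I U M j V))) < (\<Sum>V\<in>?X. \<beta> * real n)"
      using Xne by (intro sum_strict_mono) auto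
    then show False
      using ge by linarith
  qed
  then obtain V where V: "V \<in> ?X" "\<beta> * real n \<le> real (card (box_extensions I U M j V))" ..
  let ?V = "V(j := box_extensions I U M j V)"
  have "Pi\<^sub>E (insert j I) ?V \<subseteq> M"
    unfolding PiE_insert_subset_iff[of j I V "box_extensions I U M j V" M]
    by (auto simp: box_extensions_def)
  moreover have "?V i \<subseteq> U i" if "i \<in> insert j I" for i
    using that V(1) I by (auto simp: PiE_iff box_extensions_def)
  moreover have "card (?V i) = s i" if "i \<in> I" for i
    using that V(1) I by (auto simp: PiE_iff)
  ultimately show ?thesis
    using V(2) unfolding \<beta>_def by (intro exI[of _ ?V]) simp
qed

section \<open>Numerical estimates for the final density\<close>

text \<open>The bound \<open>ln y \<le> y - 1\<close> is applied at \<open>1 / sqrt x\<close>; at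
  \<open>1 / x\<close> it would give only \<open>1 - x\<close>, which does not tend to 0 with
  \<open>x\<close>.\<close>

lemma mult_ln_inverse_le_sqrt:
  fixes x :: real
  assumes "x > 0"
  shows "x * ln (1 / x) \<le> 2 * sqrt x"
proof -
  have "ln (1 / x) = 2 * ln (1 / sqrt x)"
    using assms by (simp add: ln_div ln_sqrt)
  also have "\<dots> \<le> 2 * (1 / sqrt x)"
    using assms ln_le_minus_one[of "1 / sqrt x"] by simp
  finally have "x * ln (1 / x) \<le> x * (2 * (1 / sqrt x))"
    using assms by (intro mult_left_mono) auto
  also have "\<dots> = 2 * (x / sqrt x)"
    by simp
  also have "\<dots> = 2 * sqrt x"
    using assms by (simp only: real_div_sqrt less_imp_le)
  finally show ?thesis .
qed

text \<open>The budget splits as 1/2 = 7/18 + 1/9. The second share comes from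
  \<open>r\<^sup>2 \<ge> 9\<close>, which gives \<open>\<alpha> * r \<le> 1/9\<close>.\<close>

lemma entropy_bound:
  fixes \<alpha> :: real
  assumes "r \<ge> 3" "0 < \<alpha>" "\<alpha> * real r ^ 3 \<le> 1"
  shows "\<alpha> * (ln (1 / \<alpha>) + real (r - 1) * ln 2) \<le> 1 / 2"
proof -
  have r9: "9 * real r \<le> real r ^ 3"
  proof -
    have "9 * real r \<le> real r ^ 2 * real r"
      using assms power_mono[of 3 "real r" 2] by (intro mult_right_mono) auto
    then show ?thesis
      by (simp add: power3_eq_cube power2_eq_square)
  qed
  have "\<alpha> * 27 \<le> \<alpha> * real r ^ 3"
    using assms r9 by (intro mult_left_mono) auto
  then have "\<alpha> * 27 \<le> 1"
    using assms(3) by (rule order_trans)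
  \<comment> \<open>A rational slightly above the square root of 1/27, with double exactly
    7/18.\<close>
  then have "\<alpha> \<le> (7/36)\<^sup>2"
    by (simp add: power2_eq_square)
  then have "sqrt \<alpha> \<le> 7/36"
    by (intro real_le_lsqrt) auto
  then have 1: "\<alpha> * ln (1 / \<alpha>) \<le> 7/18"
    using mult_ln_inverse_le_sqrt[OF assms(2)] by linarith
  have "real (r - 1) * ln 2 \<le> real r * 1"
    using ln_le_minus_one[of 2] by (intro mult_mono) auto
  then have "9 * (\<alpha> * (real (r - 1) * ln 2)) \<le> \<alpha> * (9 * real r)"
    using assms by simp
  also have "\<dots> \<le> \<alpha> * real r ^ 3"
    using assms r9 by (intro mult_left_mono) auto
  finally have "\<alpha> * (real (r - 1) * ln 2) \<le> 1/9"
    using assms by linarith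
  then show ?thesis
    using 1 by (simp add: distrib_left)
qed

text \<open>In logarithms, the density costs \<open>P * ?h\<close>. One factor
  \<open>\<alpha>\<close> of the bound on \<open>P\<close> is spent on \<open>?h\<close> through
  \<open>entropy_bound\<close>, leaving at most half of
  \<open>\<alpha> ^ (r - 2) * ln n\<close>.\<close>

lemma box_density_ge:
  fixes \<alpha> :: real
  assumes "r \<ge> 3" "n \<ge> 2" "0 < \<alpha>" "\<alpha> * real r ^ 3 \<le> 1" "real P \<le> \<alpha> ^ (r - 1) * ln (real n)"
  shows "(\<alpha> / 2 ^ (r - 1)) ^ P * real n \<ge> real n powr (1 - \<alpha> ^ (r - 2) / 2)"
proof -
  let ?L = "ln (real n)" and ?h = "ln (1 / \<alpha>) + real (r - 1) * ln 2"
  have L: "?L > 0"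
    using assms by simp
  have "1 \<le> real r ^ 3"
    using assms by (intro one_le_power) auto
  then have "\<alpha> * 1 \<le> \<alpha> * real r ^ 3"
    using assms by (intro mult_left_mono) auto
  then have "\<alpha> \<le> 1"
    using assms by linarith
  then have h0: "?h \<ge> 0"
    using assms by (intro add_nonneg_nonneg) auto
  have "real P * ?h \<le> \<alpha> ^ (r - 1) * ?L * ?h"
    using assms h0 by (intro mult_right_mono) auto
  also have "\<alpha> ^ (r - 1) = \<alpha> ^ (r - 2) * \<alpha>"
    using assms by (simp add: power_Suc2[symmetric] Suc_diff_Suc numeral_2_eq_2)
  also have "\<alpha> ^ (r - 2) * \<alpha> * ?L * ?h = \<alpha> ^ (r - 2) * ?L * (\<alpha> * ?h)"
    by (simp only: mult_ac)
  also have "\<dots> \<le> \<alpha> ^ (r - 2) * ?L * (1 / 2)"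
    using assms L entropy_bound[of r \<alpha>] by (intro mult_left_mono) auto
  finally have le: "real P * ?h \<le> \<alpha> ^ (r - 2) / 2 * ?L"
    by simp
  have "ln (\<alpha> / 2 ^ (r - 1)) = - ?h"
    using assms by (simp add: ln_div ln_realpow)
  then have "\<alpha> / 2 ^ (r - 1) = exp (- ?h)"
    using assms by (metis divide_pos_pos exp_ln zero_less_numeral zero_less_power)
  then have "(\<alpha> / 2 ^ (r - 1)) ^ P = exp (real P * (- ?h))"
    by (simp only: exp_of_nat_mult)
  then have "(\<alpha> / 2 ^ (r - 1)) ^ P * real n = exp (real P * (- ?h)) * exp ?L"
    using assms by simp
  also have "\<dots> = exp (?L - real P * ?h)"
    unfolding exp_add[symmetric] by (rule arg_cong[of _ _ exp]) (simp add: algebra_simps)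
  finally have "(\<alpha> / 2 ^ (r - 1)) ^ P * real n = exp (?L - real P * ?h)" .
  moreover have "real n powr (1 - \<alpha> ^ (r - 2) / 2) = exp (?L - \<alpha> ^ (r - 2) / 2 * ?L)"
    using assms by (simp add: powr_def algebra_simps)
  ultimately show ?thesis
    using le by simp
qed

section \<open>Checking the size conditions and choosing the box\<close>

theorem theorem3:
  fixes r n :: nat
    and \<alpha> :: real
    and U :: "nat \<Rightarrow> 'a set"
    and M :: "(nat \<Rightarrow> 'a) set"
    and s :: "nat \<Rightarrow> nat"
  assumes "r \<ge> 3"
    and "n \<ge> 2"
    and "ln (real n) powr (- 1 / (real r - 1)) \<le> \<alpha>"
    and "\<alpha> \<le> real r powr (- 3)"
    and "\<And>i. i \<in> {1..r} \<Longrightarrow> card (U i) = n"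
    and "M \<subseteq> (\<Pi>\<^sub>E i\<in>{1..r}. U i)"
    and "real (card M) \<ge> \<alpha> * real n ^ r"
    and "\<And>i. i \<in> {1..<r} \<Longrightarrow> s i > 0"
    and "1 \<le> (\<Prod>i=1..<r. s i)"
    and "real (\<Prod>i=1..<r. s i) \<le> \<alpha> ^ (r - 1) * ln (real n)"
  shows "\<exists>V :: nat \<Rightarrow> 'a set.
           (\<forall>i\<in>{1..r}. V i \<subseteq> U i) \<and>
           (\<Pi>\<^sub>E i\<in>{1..r}. V i) \<subseteq> M \<and>
           (\<forall>i\<in>{1..<r}. card (V i) = s i) \<and>
           real (card (V r)) > real n powr (1 - \<alpha> ^ (r - 2))"
proof -
  define P where "P = (\<Prod>i=1..<r. s i)"
  define \<beta> where "\<beta> = (\<alpha> / 2 ^ (r - 1)) ^ P"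
  have L: "ln (real n) > 0"
    using assms(2) by simp
  then have "0 < ln (real n) powr (- 1 / (real r - 1))"
    by simp
  then have \<alpha>0: "\<alpha> > 0"
    using assms(3) by linarith
  have "real r powr (- 3) = 1 / real r ^ 3"
    using assms(1) by (simp add: powr_minus_divide)
  then have "\<alpha> \<le> 1 / real r ^ 3"
    using assms(4) by metis
  then have \<alpha>r: "\<alpha> * real r ^ 3 \<le> 1"
    using assms(1) by (simp add: field_simps)
  have "(3::real) ^ 3 \<le> real r ^ 3"
    using assms(1) by (intro power_mono) auto
  then have "\<alpha> * 27 \<le> \<alpha> * real r ^ 3"
    using \<alpha>0 by (intro mult_left_mono) auto
  then have \<alpha>27: "\<alpha> \<le> 1 / 27"
    using \<alpha>r by linarith
  have \<alpha>pow: "0 < \<alpha> ^ (r - 2)" "\<alpha> ^ (r - 2) \<le> 1"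
    using \<alpha>0 \<alpha>27 by (auto intro: power_le_one)
  have \<beta>: "\<beta> * real n \<ge> real n powr (1 - \<alpha> ^ (r - 2) / 2)"
    unfolding \<beta>_def using assms \<alpha>0 \<alpha>r by (intro box_density_ge) (auto simp: P_def)
  \<comment> \<open>Each \<open>s i\<close> is at most \<open>P\<close>, which is at most
    \<open>ln n / 27\<close>, hence at most \<open>2 * sqrt n / 27\<close>. The lower bound on
    \<open>\<beta> * n\<close> is a power of \<open>n\<close> with exponent at least 1/2, so it
    dominates \<open>sqrt n\<close>.\<close>
  have "2 * real (s i) \<le> \<beta> * real n" if i: "i \<in> {1..<r}" for i
  proof -
    have "s i \<le> P"
    proof -
      have "s i dvd P"
        unfolding P_def using i by (intro dvd_prodI) auto
      then show ?thesis
        by (rule dvd_imp_le) (use assms(9)[folded P_def] in linarith)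
    qed
    then have "real (s i) \<le> \<alpha> ^ (r - 1) * ln (real n)"
      using assms(10)[folded P_def] by linarith
    also have "\<alpha> ^ (r - 1) \<le> \<alpha> ^ 1"
      using \<alpha>0 \<alpha>27 assms(1) by (intro power_decreasing) auto
    then have "\<alpha> ^ (r - 1) * ln (real n) \<le> 1 / 27 * ln (real n)"
      using \<alpha>27 L by (intro mult_right_mono) auto
    also have "ln (real n) \<le> 2 * sqrt (real n)"
      using assms(2) ln_le_minus_one[of "sqrt (real n)"] by (simp add: ln_sqrt)
    finally have "2 * real (s i) \<le> sqrt (real n)"
      by simp
    also have "sqrt (real n) = real n powr (1 / 2)"
      by (simp add: powr_half_sqrt)
    also have "\<dots> \<le> real n powr (1 - \<alpha> ^ (r - 2) / 2)"
      using assms(2) \<alpha>pow by (intro powr_mono) auto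
    finally show ?thesis
      using \<beta> by linarith
  qed
  moreover have I: "insert r {1..<r} = {1..r}"
    using assms(1) by auto
  ultimately obtain V where V: "\<forall>i\<in>{1..r}. V i \<subseteq> U i" "Pi\<^sub>E {1..r} V \<subseteq> M"
      "\<forall>i\<in>{1..<r}. card (V i) = s i" "real (card (V r)) \<ge> \<beta> * real n"
    using exists_large_box[of "{1..<r}" r U n M \<alpha> s] assms \<alpha>0 \<alpha>27
    unfolding I by (auto simp: \<beta>_def P_def)
  \<comment> \<open>The halved deficit in the exponent yields the strict inequality, as
    \<open>n > 1\<close> and \<open>\<alpha> > 0\<close>.\<close>
  have "real n powr (1 - \<alpha> ^ (r - 2)) < real n powr (1 - \<alpha> ^ (r - 2) / 2)"
    using assms(2) \<alpha>pow by (intro powr_less_mono) auto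
  then have "real (card (V r)) > real n powr (1 - \<alpha> ^ (r - 2))"
    using V(4) \<beta> by linarith
  then show ?thesis
    using V by (intro exI[of _ V]) simp
qed

end
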